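(* Let $(\Lambda,d)$ be a finitely aligned $k$-graph and let $\mathcal{E}\subset\mathrm{FE}(\Lambda)$. Then $\Sigma^\infty(\mathcal{E})=\overline{\mathcal{E}}$.
   Context: $k$-graphs. $\mathbb{N}$ contains $0$; $\mathbb{N}^k$ is ordered coordinatewise, $m\vee n$ is the coordinatewise maximum, and $0<n$ means $n \ge 0$, $n\neq 0$. For $k\in\mathbb{N}\setminus\{0\}$, a $k$-graph is a pair $(\Lambda,d)$ where $\Lambda$ is a countable category and $d:\Lambda\to\mathbb{N}^k$ is a functor satisfying the factorisation property: for every morphism $\lambda$ and all $m,n\in\mathbb{N}^k$ with $d(\lambda)=m+n$ there are unique morphisms $\mu,\nu$ with $d(\mu)=m$, $d(\nu)=n$, $\lambda=\mu\nu$. Write $\lambda\in\Lambda$ for morphisms ("paths"), $r,s$ for codomain and domain (so $\lambda\mu$ is defined when $s(\lambda)=r(\mu)$); objects ("vertices") are identified with the elements of $\Lambda^0=\{\lambda: d(\lambda)=0\}$. For $v\in\Lambda^0$, $v\Lambda=\{\lambda: r(\lambda)=v\}$. For $E\subset\Lambda$, $\lambda E=\{\lambda\mu:\mu\in E, r(\mu)=s(\lambda)\}$ and $E\Lambda=\{\lambda\mu:\lambda\in E,\ \mu \in s(\lambda)\Lambda\}$. For $l\le m\le d(\lambda)$, $\lambda(l,m)$ is the unique path of degree $m-l$ with $\lambda=\lambda(0,l)\lambda(l,m)\lambda(m,d(\lambda))$. Finite exhaustive sets. For $\mu,\nu\in\Lambda$, $\mathrm{MCE}(\mu,\nu)$ is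 the set of $\lambda$ with $d(\lambda)=d(\mu)\vee d(\nu)$, $\lambda(0,d(\mu))=\mu$, $\lambda(0,d(\nu))=\nu$; $\Lambda^{\min}(\mu,\nu)=\{(\alpha,\beta)\in \Lambda\times\Lambda:\mu\alpha=\nu\beta\in\mathrm{MCE}(\mu,\nu)\}$. $\Lambda$ is finitely aligned if every $\mathrm{MCE}(\mu,\nu)$ is finite (possibly empty). For $E\subset\Lambda$, $\mathrm{Ext}(\mu;E)=\{\alpha\in s(\mu)\Lambda:(\alpha,\beta)\in\Lambda^{\min}(\mu,\nu)\text{ for some }\nu\in E \text{ and some } \beta\}$. A set $E\subset v\Lambda$ is exhaustive if $\mathrm{Ext}(\lambda;E)\neq\emptyset$ for all $\lambda\in v\Lambda$. $\mathrm{FE}(\Lambda)=\bigcup_{v\in\Lambda^0}\{E\subset v\Lambda\setminus\{v\}: E\text{ finite and exhaustive}\}$; for $E\in\mathrm{FE}(\Lambda)$, $r(E)$ is the vertex $v$ with $E\subset v\Lambda$. For $\mathcal{E}\subset\mathrm{FE}(\Lambda)$, $v\mathcal{E}=\{E\in\mathcal{E}:r(E)=v\}$. Satiated; satiation. $\mathcal{E}\subset\mathrm{FE}(\Lambda)$ is satiated if: (S1) $G\in\mathcal{E}$, $E\in\mathrm{FE}(\Lambda)$, $G\subset E$ imply $E\in\mathcal{E}$; (S2) if $G\in\mathcal{E}$ with $r(G)=v$ and $\mu\in v\Lambda\setminus G\Lambda$, then $\mathrm{Ext}(\mu;G)\in\mathcal{E}$; (S3) if $G\in\mathcal{E}$ and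 $0<n_\lambda\le d(\lambda)$ for each $\lambda\in G$, then $\{\lambda(0,n_\lambda):\lambda\in G\}\in\mathcal{E}$; (S4) if $G\in\mathcal{E}$, $G'\subset G$ and $G'_\lambda\in\mathcal{E}$ with $r(G'_\lambda)=s(\lambda)$ for each $\lambda\in G'$, then $(G\setminus G')\cup\bigcup_{\lambda\in G'}\lambda G'_\lambda\in\mathcal{E}$. The satiation $\overline{\mathcal{E}}$ of $\mathcal{E}$ is the smallest satiated subset of $\mathrm{FE}(\Lambda)$ containing $\mathcal{E}$. The maps $\Sigma_i$. For $\mathcal{E}\subset\mathrm{FE}(\Lambda)$: $\Sigma_1(\mathcal{E})=\{F: F\text{ is finite and there exists }E\in\mathcal{E}\text{ with }E\subset F\subset r(E)\Lambda\setminus\Lambda^0\}$; $\Sigma_2(\mathcal{E})=\{\mathrm{Ext}(\mu;E):E\in\mathcal{E},\ \mu\in r(E)\Lambda\setminus E\Lambda\}$; $\Sigma_3(\mathcal{E})=\{\{\lambda(0,n_\lambda):\lambda\in E\}:E\in\mathcal{E},\ 0<n_\lambda\le d(\lambda)\text{ for all }\lambda\in E\}$; $\Sigma_4(\mathcal{E})=\{(E\setminus F)\cup\bigcup_{\lambda\in F}\lambda F_\lambda:E\in\mathcal{E},\ F\subset E,\ F_\lambda\in s(\lambda)\mathcal{E}\text{ for all }\lambda\in F\}$. Each $\Sigma_i$ maps subsets of $\mathrm{FE}(\Lambda)$ to subsets of $\mathrm{FE}(\Lambda)$. Put $\Sigma=\Sigma_4\circ\Sigma_3\circ\Sigma_2\circ\Sigma_1$,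 let $\Sigma^n$ be its $n$-fold iterate, and $\Sigma^\infty(\mathcal{E})=\bigcup_{n=1}^\infty\Sigma^n(\mathcal{E})$. *)

theory Defs
  imports "HOL-Analysis.Finite_Cartesian_Product"
begin

text \<open>
  A category is presented by its morphisms alone: \<open>paths\<close> is the set of morphisms, objects are
  identified with their identity morphisms, and \<open>rng\<close>, \<open>src\<close> (codomain, domain) send a morphism to
  an identity morphism. The product \<open>p \<cdot> q\<close> is meaningful only if \<open>src p = rng q\<close>.
  Degrees lie in \<open>nat ^ 'k\<close>, i.e. in the set of k-tuples with k = CARD('k) nonzero; addition,
  \<open>\<le>\<close> and \<open><\<close> on this type are the coordinatewise ones (\<open>m < n\<close> means \<open>m \<le> n\<close> and \<open>m \<noteq> n\<close>).
\<close>

record ('p, 'k) kgraph =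
  paths :: "'p set"
  rng :: "'p \<Rightarrow> 'p"
  src :: "'p \<Rightarrow> 'p"
  pcomp :: "'p \<Rightarrow> 'p \<Rightarrow> 'p"  (infixl "\<cdot>\<index>" 70)
  deg :: "'p \<Rightarrow> nat ^ 'k"

locale countable_category =
  fixes L :: "('p, 'k::finite) kgraph" (structure)
  assumes countable_paths: "countable (paths L)"
    and rng_closed: "p \<in> paths L \<Longrightarrow> rng L p \<in> paths L"
    and src_closed: "p \<in> paths L \<Longrightarrow> src L p \<in> paths L"
    and rng_rng: "p \<in> paths L \<Longrightarrow> rng L (rng L p) = rng L p"
    and src_rng: "p \<in> paths L \<Longrightarrow> src L (rng L p) = rng L p"
    and rng_src: "p \<in> paths L \<Longrightarrow> rng L (src L p) = src L p"
    and src_src: "p \<in> paths L \<Longrightarrow> src L (src L p) = src L p"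
    and comp_closed:
      "\<lbrakk>p \<in> paths L; q \<in> paths L; src L p = rng L q\<rbrakk> \<Longrightarrow> p \<cdot> q \<in> paths L"
    and rng_comp:
      "\<lbrakk>p \<in> paths L; q \<in> paths L; src L p = rng L q\<rbrakk> \<Longrightarrow> rng L (p \<cdot> q) = rng L p"
    and src_comp:
      "\<lbrakk>p \<in> paths L; q \<in> paths L; src L p = rng L q\<rbrakk> \<Longrightarrow> src L (p \<cdot> q) = src L q"
    and comp_assoc:
      "\<lbrakk>p \<in> paths L; q \<in> paths L; t \<in> paths L; src L p = rng L q; src L q = rng L t\<rbrakk>
        \<Longrightarrow> (p \<cdot> q) \<cdot> t = p \<cdot> (q \<cdot> t)"
    and rng_comp_id: "p \<in> paths L \<Longrightarrow> rng L p \<cdot> p = p"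
    and comp_src_id: "p \<in> paths L \<Longrightarrow> p \<cdot> src L p = p"

locale k_graph = countable_category L for L :: "('p, 'k::finite) kgraph" (structure) +
  assumes deg_id: "p \<in> paths L \<Longrightarrow> deg L (rng L p) = 0" "p \<in> paths L \<Longrightarrow> deg L (src L p) = 0"
    and deg_comp:
      "\<lbrakk>p \<in> paths L; q \<in> paths L; src L p = rng L q\<rbrakk> \<Longrightarrow> deg L (p \<cdot> q) = deg L p + deg L q"
    and factorisation:
      "\<lbrakk>p \<in> paths L; deg L p = m + n\<rbrakk> \<Longrightarrow>
        \<exists>!(x, y). x \<in> paths L \<and> y \<in> paths L \<and> deg L x = m \<and> deg L y = n
                  \<and> src L x = rng L y \<and> p = x \<cdot> y"

definition vertices :: "('p, 'k::finite) kgraph \<Rightarrow> 'p set" where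
  "vertices L = {p \<in> paths L. deg L p = 0}"

definition paths_at :: "('p, 'k::finite) kgraph \<Rightarrow> 'p \<Rightarrow> 'p set" where
  "paths_at L v = {p \<in> paths L. rng L p = v}"

definition path_times_set :: "('p, 'k::finite) kgraph \<Rightarrow> 'p \<Rightarrow> 'p set \<Rightarrow> 'p set" where
  "path_times_set L p E = {pcomp L p q | q. q \<in> E \<and> rng L q = src L p}"

definition extensions_of :: "('p, 'k::finite) kgraph \<Rightarrow> 'p set \<Rightarrow> 'p set" where
  "extensions_of L E = {pcomp L p q | p q. p \<in> E \<and> q \<in> paths_at L (src L p)}"

text \<open>
  \<open>segment L p l m\<close> is the middle factor of \<open>p\<close> in degrees \<open>l\<close>, \<open>m - l\<close>, \<open>deg L p - m\<close>; it is
  meaningful for \<open>l \<le> m \<le> deg L p\<close>, and only then is the truncated subtraction a true one.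
\<close>

definition segment :: "('p, 'k::finite) kgraph \<Rightarrow> 'p \<Rightarrow> nat ^ 'k \<Rightarrow> nat ^ 'k \<Rightarrow> 'p" where
  "segment L p l m =
     (THE q. q \<in> paths L \<and> deg L q = m - l \<and>
        (\<exists>x \<in> paths L. \<exists>y \<in> paths L. deg L x = l \<and> deg L y = deg L p - m \<and>
           src L x = rng L q \<and> src L q = rng L y \<and> p = pcomp L (pcomp L x q) y))"

definition degree_join :: "nat ^ 'k \<Rightarrow> nat ^ 'k \<Rightarrow> nat ^ 'k::finite" where
  "degree_join m n = (\<chi> i. max (m $ i) (n $ i))"

definition MCE :: "('p, 'k::finite) kgraph \<Rightarrow> 'p \<Rightarrow> 'p \<Rightarrow> 'p set" where
  "MCE L p q = {t \<in> paths L. deg L t = degree_join (deg L p) (deg L q) \<and>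
                  segment L t 0 (deg L p) = p \<and> segment L t 0 (deg L q) = q}"

definition Lambda_min :: "('p, 'k::finite) kgraph \<Rightarrow> 'p \<Rightarrow> 'p \<Rightarrow> ('p \<times> 'p) set" where
  "Lambda_min L p q = {(a, b). a \<in> paths L \<and> b \<in> paths L \<and> src L p = rng L a \<and> src L q = rng L b \<and>
                         pcomp L p a = pcomp L q b \<and> pcomp L p a \<in> MCE L p q}"

definition Ext :: "('p, 'k::finite) kgraph \<Rightarrow> 'p \<Rightarrow> 'p set \<Rightarrow> 'p set" where
  "Ext L p E = {a \<in> paths_at L (src L p). \<exists>q \<in> E. \<exists>b. (a, b) \<in> Lambda_min L p q}"

locale finitely_aligned_k_graph = k_graph L for L :: "('p, 'k::finite) kgraph" (structure) +
  assumes finite_MCE: "\<lbrakk>p \<in> paths L; q \<in> paths L\<rbrakk> \<Longrightarrow> finite (MCE L p q)"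

definition exhaustive :: "('p, 'k::finite) kgraph \<Rightarrow> 'p \<Rightarrow> 'p set \<Rightarrow> bool" where
  "exhaustive L v E \<longleftrightarrow> E \<subseteq> paths_at L v \<and> (\<forall>p \<in> paths_at L v. Ext L p E \<noteq> {})"

definition FE :: "('p, 'k::finite) kgraph \<Rightarrow> 'p set set" where
  "FE L = (\<Union>v \<in> vertices L. {E. E \<subseteq> paths_at L v - {v} \<and> finite E \<and> exhaustive L v E})"

text \<open>The members of \<open>FE L\<close> are nonempty, so the following vertex is unique for them.\<close>

definition set_rng :: "('p, 'k::finite) kgraph \<Rightarrow> 'p set \<Rightarrow> 'p" where
  "set_rng L E = (THE v. v \<in> vertices L \<and> E \<subseteq> paths_at L v)"

definition members_at :: "('p, 'k::finite) kgraph \<Rightarrow> 'p \<Rightarrow> 'p set set \<Rightarrow> 'p set set" where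
  "members_at L v \<E> = {E \<in> \<E>. set_rng L E = v}"

definition satiated :: "('p, 'k::finite) kgraph \<Rightarrow> 'p set set \<Rightarrow> bool" where
  "satiated L \<E> \<longleftrightarrow>
     \<E> \<subseteq> FE L \<and>
     (\<forall>G \<in> \<E>. \<forall>E \<in> FE L. G \<subseteq> E \<longrightarrow> E \<in> \<E>) \<and>
     (\<forall>G \<in> \<E>. \<forall>p \<in> paths_at L (set_rng L G) - extensions_of L G. Ext L p G \<in> \<E>) \<and>
     (\<forall>G \<in> \<E>. \<forall>n. (\<forall>p \<in> G. 0 < n p \<and> n p \<le> deg L p) \<longrightarrow> {segment L p 0 (n p) | p. p \<in> G} \<in> \<E>) \<and>
     (\<forall>G \<in> \<E>. \<forall>G' H. G' \<subseteq> G \<and> (\<forall>p \<in> G'. H p \<in> \<E> \<and> set_rng L (H p) = src L p) \<longrightarrow>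
        (G - G') \<union> (\<Union>p \<in> G'. path_times_set L p (H p)) \<in> \<E>)"

definition satiation :: "('p, 'k::finite) kgraph \<Rightarrow> 'p set set \<Rightarrow> 'p set set" where
  "satiation L \<E> = (LEAST \<F>. \<F> \<subseteq> FE L \<and> satiated L \<F> \<and> \<E> \<subseteq> \<F>)"

definition Sigma1 :: "('p, 'k::finite) kgraph \<Rightarrow> 'p set set \<Rightarrow> 'p set set" where
  "Sigma1 L \<E> = {F. finite F \<and> (\<exists>E \<in> \<E>. E \<subseteq> F \<and> F \<subseteq> paths_at L (set_rng L E) - vertices L)}"

definition Sigma2 :: "('p, 'k::finite) kgraph \<Rightarrow> 'p set set \<Rightarrow> 'p set set" where
  "Sigma2 L \<E> = {Ext L p E | p E. E \<in> \<E> \<and> p \<in> paths_at L (set_rng L E) - extensions_of L E}"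

definition Sigma3 :: "('p, 'k::finite) kgraph \<Rightarrow> 'p set set \<Rightarrow> 'p set set" where
  "Sigma3 L \<E> = {{segment L p 0 (n p) | p. p \<in> E} | E n.
                   E \<in> \<E> \<and> (\<forall>p \<in> E. 0 < n p \<and> n p \<le> deg L p)}"

definition Sigma4 :: "('p, 'k::finite) kgraph \<Rightarrow> 'p set set \<Rightarrow> 'p set set" where
  "Sigma4 L \<E> = {(E - F) \<union> (\<Union>p \<in> F. path_times_set L p (H p)) | E F H.
                   E \<in> \<E> \<and> F \<subseteq> E \<and> (\<forall>p \<in> F. H p \<in> members_at L (src L p) \<E>)}"

definition Sigma_map :: "('p, 'k::finite) kgraph \<Rightarrow> 'p set set \<Rightarrow> 'p set set" where
  "Sigma_map L = Sigma4 L \<circ> Sigma3 L \<circ> Sigma2 L \<circ> Sigma1 L"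

definition Sigma_infinity :: "('p, 'k::finite) kgraph \<Rightarrow> 'p set set \<Rightarrow> 'p set set" where
  "Sigma_infinity L \<E> = (\<Union>n \<in> {1..}. (Sigma_map L ^^ n) \<E>)"

lemma (in k_graph) factorisation_unique:
  assumes "x \<in> paths L" "y \<in> paths L" "src L x = rng L y"
    and "x' \<in> paths L" "y' \<in> paths L" "src L x' = rng L y'"
    and "x \<cdot> y = x' \<cdot> y'" "deg L x = deg L x'" "deg L y = deg L y'"
  shows "x = x' \<and> y = y'"
proof -
  let ?P = "\<lambda>z. case z of (a, b) \<Rightarrow> a \<in> paths L \<and> b \<in> paths L \<and> deg L a = deg L x
                \<and> deg L b = deg L y \<and> src L a = rng L b \<and> x \<cdot> y = a \<cdot> b"
  have ex: "\<exists>!z. ?P z"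
    using factorisation[OF comp_closed[OF assms(1-3)] deg_comp[OF assms(1-3)]] .
  have "?P (x, y)" using assms by simp
  moreover have "?P (x', y')" using assms by simp
  ultimately have "(x, y) = (x', y')" using ex by (blast dest: ex1_implies_ex elim: ex1E)
  then show ?thesis by simp
qed

lemma (in k_graph) vertices_eq_identities: "vertices L = rng L ` paths L"
proof
  show "rng L ` paths L \<subseteq> vertices L"
    by (auto simp: vertices_def rng_closed deg_id)
  show "vertices L \<subseteq> rng L ` paths L"
  proof
    fix p assume "p \<in> vertices L"
    then have p: "p \<in> paths L" "deg L p = 0" by (auto simp: vertices_def)
    have "rng L p = p \<and> p = src L p"
      using p by (intro factorisation_unique)
        (simp_all add: rng_closed src_closed src_rng rng_src rng_comp_id comp_src_id deg_id)
    then show "p \<in> rng L ` paths L" using p(1) by (metis image_eqI)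
  qed
qed

lemma (in k_graph) segment_0_eq:
  assumes "x \<in> paths L" "y \<in> paths L" "src L x = rng L y"
  shows "segment L (x \<cdot> y) 0 (deg L x) = x"
  unfolding segment_def
proof (rule the_equality)
  have d: "deg L (x \<cdot> y) - deg L x = deg L y" using assms by (simp add: deg_comp vec_eq_iff)
  show "x \<in> paths L \<and> deg L x = deg L x - 0 \<and>
     (\<exists>u \<in> paths L. \<exists>z \<in> paths L. deg L u = 0 \<and> deg L z = deg L (x \<cdot> y) - deg L x \<and>
        src L u = rng L x \<and> src L x = rng L z \<and> x \<cdot> y = (u \<cdot> x) \<cdot> z)"
    using assms d rng_closed src_rng deg_id(1) rng_comp_id
    by (intro conjI bexI[of _ "rng L x"] bexI[of _ y]) (simp_all add: vec_eq_iff)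
next
  fix q
  assume "q \<in> paths L \<and> deg L q = deg L x - 0 \<and>
     (\<exists>u \<in> paths L. \<exists>z \<in> paths L. deg L u = 0 \<and> deg L z = deg L (x \<cdot> y) - deg L x \<and>
        src L u = rng L q \<and> src L q = rng L z \<and> x \<cdot> y = (u \<cdot> q) \<cdot> z)"
  then obtain u z where q: "q \<in> paths L" "deg L q = deg L x - 0" "u \<in> paths L" "z \<in> paths L"
      "deg L u = 0" "deg L z = deg L (x \<cdot> y) - deg L x" "src L u = rng L q" "src L q = rng L z"
      "x \<cdot> y = (u \<cdot> q) \<cdot> z"
    by blast
  have "u \<in> rng L ` paths L"
    using q(3,5) unfolding vertices_eq_identities[symmetric] vertices_def by simp
  then have "u = rng L q" using q(7) src_rng by auto
  then have eq: "x \<cdot> y = q \<cdot> z" using q(9) rng_comp_id[OF q(1)] by simp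
  have dz: "deg L y = deg L z" using q(6) assms by (simp add: deg_comp vec_eq_iff)
  have dq: "deg L x = deg L q" using q(2) by (simp add: vec_eq_iff)
  show "q = x"
    using factorisation_unique[OF assms q(1,4,8) eq dq dz] by simp
qed

end

theory Submission
  imports Defs
begin

text \<open>
  Each condition (S\<open>i\<close>) on a family in \<open>FE L\<close> says that the family is closed under \<open>\<Sigma>\<^sub>i\<close>. Every
  \<open>\<Sigma>\<^sub>i\<close> is monotone, maps \<open>FE L\<close> to itself, and is extensive on it: a trivial choice of data
  (\<open>F = E\<close>, \<open>\<mu> = r(E)\<close>, \<open>n\<^sub>\<lambda> = d(\<lambda>)\<close>, \<open>F = \<emptyset>\<close> respectively) gives back \<open>E\<close>. So the iterates of \<open>\<Sigma>\<close>
  form an increasing chain that starts with \<open>\<E>\<close> and stays inside any satiated family containing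
  \<open>\<E>\<close>. The union of the chain is itself satiated: an instance of (S1), (S2) or (S3) starts from a
  single member, hence takes place at one stage, and its result appears at the next one. An
  instance of (S4) involves one set \<open>G\<close> and a set for each element of \<open>G' \<subseteq> G\<close>; since \<open>G\<close> is
  finite, all of these lie in a common stage.

  The combinatorial content is that the \<open>\<Sigma>\<^sub>i\<close> preserve \<open>FE L\<close>. It rests on reading
  exhaustiveness through the prefix order: by the factorisation property, two paths with any common
  extension have a minimal one, and it is a prefix of the given extension. Hence \<open>E\<close> is
  exhaustive at \<open>v\<close> exactly when every path with range \<open>v\<close> has a common extension with some member
  of \<open>E\<close>, a form in which extending, truncating, composing and translating are all easy.
\<close>

section \<open>The prefix order on paths\<close>

context k_graph
begin

definition is_prefix :: "'p \<Rightarrow> 'p \<Rightarrow> bool"  (infix "\<preceq>" 50) where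
  "p \<preceq> t \<longleftrightarrow> p \<in> paths L \<and> (\<exists>x \<in> paths L. src L p = rng L x \<and> t = p \<cdot> x)"

lemma prefix_comp:
  "\<lbrakk>p \<in> paths L; x \<in> paths L; src L p = rng L x\<rbrakk> \<Longrightarrow> p \<preceq> p \<cdot> x"
  by (auto simp: is_prefix_def)

lemma prefix_paths:
  assumes "p \<preceq> t"
  shows "p \<in> paths L" "t \<in> paths L" "rng L p = rng L t" "deg L p \<le> deg L t"
  using assms by (auto simp: is_prefix_def comp_closed rng_comp deg_comp less_eq_vec_def)

lemma prefix_refl: "p \<in> paths L \<Longrightarrow> p \<preceq> p"
  unfolding is_prefix_def by (metis comp_src_id src_closed rng_src)

lemma prefix_trans:
  assumes "p \<preceq> q" "q \<preceq> t"
  shows "p \<preceq> t"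
proof -
  obtain x where x: "p \<in> paths L" "x \<in> paths L" "src L p = rng L x" "q = p \<cdot> x"
    using assms(1) by (auto simp: is_prefix_def)
  obtain y where y: "y \<in> paths L" "src L q = rng L y" "t = q \<cdot> y"
    using assms(2) by (auto simp: is_prefix_def)
  have xy: "src L x = rng L y" using x y by (simp add: src_comp)
  then have "t = p \<cdot> (x \<cdot> y)" using x y by (simp add: comp_assoc)
  then show ?thesis using x y xy by (simp add: prefix_comp comp_closed rng_comp)
qed

lemma prefix_exists:
  assumes "t \<in> paths L" "n \<le> deg L t"
  obtains p where "p \<preceq> t" "deg L p = n"
proof -
  have "deg L t = n + (deg L t - n)"
    using assms(2) by (simp add: vec_eq_iff less_eq_vec_def)
  from factorisation[OF assms(1) this] show ?thesis
    using that by (auto simp: is_prefix_def)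
qed

lemma segment_prefix: "p \<preceq> t \<Longrightarrow> segment L t 0 (deg L p) = p"
  by (auto simp: is_prefix_def segment_0_eq)

lemma prefix_segment:
  assumes "t \<in> paths L" "n \<le> deg L t"
  shows "segment L t 0 n \<preceq> t" "deg L (segment L t 0 n) = n"
  using prefix_exists[OF assms] segment_prefix by metis+

lemma segment_full: "p \<in> paths L \<Longrightarrow> segment L p 0 (deg L p) = p"
  by (simp add: segment_prefix prefix_refl)

text \<open>The initial segment of \<open>q\<close> of degree \<open>deg L p\<close> is one of \<open>t\<close> too, and \<open>t\<close> has only one.\<close>

lemma prefix_linear:
  assumes "p \<preceq> t" "q \<preceq> t" "deg L p \<le> deg L q"
  shows "p \<preceq> q"
proof -
  obtain p' where p': "p' \<preceq> q" "deg L p' = deg L p"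
    using prefix_exists[OF prefix_paths(1)[OF assms(2)] assms(3)] .
  then have "p' \<preceq> t" using prefix_trans assms(2) by blast
  then have "p' = p" using segment_prefix assms(1) p'(2) by metis
  then show ?thesis using p'(1) by simp
qed

lemma prefix_comp_left:
  assumes "p \<in> paths L" "src L p = rng L a" "a \<preceq> b"
  shows "p \<cdot> a \<preceq> p \<cdot> b"
proof -
  obtain x where x: "a \<in> paths L" "x \<in> paths L" "src L a = rng L x" "b = a \<cdot> x"
    using assms(3) by (auto simp: is_prefix_def)
  then have "p \<cdot> b = (p \<cdot> a) \<cdot> x" using assms by (simp add: comp_assoc)
  then show ?thesis using x assms by (simp add: prefix_comp comp_closed src_comp)
qed

lemma comp_left_cancel:
  assumes "p \<in> paths L" "a \<in> paths L" "b \<in> paths L" "src L p = rng L a" "src L p = rng L b"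
    and "p \<cdot> a = p \<cdot> b"
  shows "a = b"
proof -
  have "deg L p + deg L a = deg L p + deg L b" using assms by (metis deg_comp)
  then show ?thesis using factorisation_unique[of p a p b] assms by simp
qed

lemma prefix_cancel_left:
  assumes "p \<in> paths L" "a \<in> paths L" "b \<in> paths L" "src L p = rng L a" "src L p = rng L b"
    and "p \<cdot> a \<preceq> p \<cdot> b"
  shows "a \<preceq> b"
proof -
  obtain x where x: "x \<in> paths L" "src L (p \<cdot> a) = rng L x" "p \<cdot> b = (p \<cdot> a) \<cdot> x"
    using assms(6) by (auto simp: is_prefix_def)
  have ax: "src L a = rng L x" using x assms by (simp add: src_comp)
  then have "p \<cdot> b = p \<cdot> (a \<cdot> x)"
    using comp_assoc[OF assms(1,2) x(1) assms(4)] x(3) by simp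
  moreover have "a \<cdot> x \<in> paths L" "src L p = rng L (a \<cdot> x)"
    using comp_closed rng_comp x(1) ax assms(2,4) by auto
  ultimately have "b = a \<cdot> x" using comp_left_cancel assms(1,3,5) by blast
  then show ?thesis using prefix_comp x(1) ax assms(2) by blast
qed

lemma vertexD:
  assumes "v \<in> vertices L"
  shows "v \<in> paths L" "rng L v = v" "src L v = v" "deg L v = 0"
  using assms unfolding vertices_eq_identities
  by (auto simp: rng_closed rng_rng src_rng deg_id)

lemma src_vertex: "p \<in> paths L \<Longrightarrow> src L p \<in> vertices L"
  by (simp add: vertices_def src_closed deg_id)

lemma vertex_rng_eq: "\<lbrakk>p \<in> vertices L; rng L p = v\<rbrakk> \<Longrightarrow> p = v"
  using vertexD by simp

lemma nonvertex_iff_deg: "p \<in> paths L \<Longrightarrow> p \<notin> vertices L \<longleftrightarrow> 0 < deg L p"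
  by (auto simp: vertices_def less_vec_def less_eq_vec_def vec_eq_iff)

lemma deg_mono_nonvertex: "\<lbrakk>p \<preceq> t; p \<notin> vertices L\<rbrakk> \<Longrightarrow> t \<notin> vertices L"
  using prefix_paths[of p t] nonvertex_iff_deg[of p] nonvertex_iff_deg[of t]
    order_less_le_trans[of 0 "deg L p" "deg L t"] by blast

section \<open>Minimal common extensions and exhaustive sets\<close>

lemma degree_join_upper: "m \<le> degree_join m n" "n \<le> degree_join m n"
  by (simp_all add: degree_join_def less_eq_vec_def)

lemma degree_join_least: "\<lbrakk>m \<le> l; n \<le> l\<rbrakk> \<Longrightarrow> degree_join m n \<le> l"
  by (simp add: degree_join_def less_eq_vec_def)

lemma MCE_iff:
  "t \<in> MCE L p q \<longleftrightarrow> p \<preceq> t \<and> q \<preceq> t \<and> deg L t = degree_join (deg L p) (deg L q)"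
proof
  assume "t \<in> MCE L p q"
  then have t: "t \<in> paths L" "deg L t = degree_join (deg L p) (deg L q)"
    "segment L t 0 (deg L p) = p" "segment L t 0 (deg L q) = q"
    by (auto simp: MCE_def)
  moreover have "deg L p \<le> deg L t" "deg L q \<le> deg L t"
    unfolding t(2) by (rule degree_join_upper)+
  ultimately show "p \<preceq> t \<and> q \<preceq> t \<and> deg L t = degree_join (deg L p) (deg L q)"
    using prefix_segment(1)[of t "deg L p"] prefix_segment(1)[of t "deg L q"] by simp
next
  assume "p \<preceq> t \<and> q \<preceq> t \<and> deg L t = degree_join (deg L p) (deg L q)"
  then show "t \<in> MCE L p q" using prefix_paths segment_prefix by (auto simp: MCE_def)
qed

lemma Ext_iff:
  assumes "p \<in> paths L"
  shows "a \<in> Ext L p E \<longleftrightarrow> a \<in> paths_at L (src L p) \<and> (\<exists>q \<in> E. p \<cdot> a \<in> MCE L p q)"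
proof -
  have "(\<exists>b. (a, b) \<in> Lambda_min L p q) \<longleftrightarrow> p \<cdot> a \<in> MCE L p q"
    if "a \<in> paths_at L (src L p)" for q
    using that by (auto simp: Lambda_min_def MCE_iff is_prefix_def paths_at_def)
  then show ?thesis by (auto simp: Ext_def)
qed

text \<open>Truncating a common extension \<open>t\<close> at the join of the degrees gives a minimal one.\<close>

lemma common_extension_minimal:
  assumes "p \<preceq> t" "q \<preceq> t"
  obtains a where "a \<in> paths_at L (src L p)" "p \<cdot> a \<in> MCE L p q" "p \<cdot> a \<preceq> t"
proof -
  have "degree_join (deg L p) (deg L q) \<le> deg L t"
    using assms prefix_paths(4) by (intro degree_join_least) auto
  then obtain u where u: "u \<preceq> t" "deg L u = degree_join (deg L p) (deg L q)"
    using prefix_exists prefix_paths(2)[OF assms(1)] by blast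
  have pu: "p \<preceq> u" "q \<preceq> u"
    using assms u prefix_linear degree_join_upper by metis+
  then obtain a where "a \<in> paths L" "src L p = rng L a" "u = p \<cdot> a"
    by (auto simp: is_prefix_def)
  then show ?thesis using that u pu by (auto simp: MCE_iff paths_at_def)
qed

lemma Ext_nonempty_iff:
  assumes "p \<in> paths L"
  shows "Ext L p E \<noteq> {} \<longleftrightarrow> (\<exists>q \<in> E. \<exists>t. p \<preceq> t \<and> q \<preceq> t)"
proof
  assume "Ext L p E \<noteq> {}"
  then show "\<exists>q \<in> E. \<exists>t. p \<preceq> t \<and> q \<preceq> t" using assms by (auto simp: Ext_iff MCE_iff)
next
  assume "\<exists>q \<in> E. \<exists>t. p \<preceq> t \<and> q \<preceq> t"
  then show "Ext L p E \<noteq> {}"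
    using common_extension_minimal Ext_iff[OF assms] by (metis empty_iff)
qed

text \<open>
  Membership in \<open>FE L\<close> with the vertex made explicit and exhaustiveness expressed by arbitrary
  common extensions, so that minimality need not be tracked when sets are transformed.
\<close>

definition FE_at :: "'p \<Rightarrow> 'p set \<Rightarrow> bool" where
  "FE_at v E \<longleftrightarrow> v \<in> vertices L \<and> finite E \<and> E \<subseteq> paths_at L v - vertices L \<and>
     (\<forall>p \<in> paths_at L v. \<exists>q \<in> E. \<exists>t. p \<preceq> t \<and> q \<preceq> t)"

lemma FE_iff: "E \<in> FE L \<longleftrightarrow> (\<exists>v. FE_at v E)"
proof -
  have "E \<subseteq> paths_at L v - {v} \<and> finite E \<and> exhaustive L v E \<longleftrightarrow> FE_at v E"
    if v: "v \<in> vertices L" for v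
  proof -
    have "paths_at L v - {v} = paths_at L v - vertices L"
      using v vertexD(2) by (auto simp: paths_at_def)
    moreover have "(\<forall>p \<in> paths_at L v. Ext L p E \<noteq> {}) \<longleftrightarrow>
        (\<forall>p \<in> paths_at L v. \<exists>q \<in> E. \<exists>t. p \<preceq> t \<and> q \<preceq> t)"
      by (intro ball_cong refl Ext_nonempty_iff) (simp add: paths_at_def)
    ultimately show ?thesis using v unfolding FE_at_def exhaustive_def by blast
  qed
  then show ?thesis unfolding FE_def FE_at_def by blast
qed

lemma FE_atI:
  "\<lbrakk>v \<in> vertices L; E \<subseteq> paths_at L v - vertices L; finite E;
    \<And>p. p \<in> paths_at L v \<Longrightarrow> \<exists>q \<in> E. \<exists>t. p \<preceq> t \<and> q \<preceq> t\<rbrakk> \<Longrightarrow> FE_at v E"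
  by (simp add: FE_at_def)

lemma FE_at_common_extension:
  assumes "FE_at v E" "p \<in> paths_at L v"
  obtains q t where "q \<in> E" "p \<preceq> t" "q \<preceq> t"
  using assms by (auto simp: FE_at_def)

text \<open>
  Applied to the path \<open>v\<close> itself, exhaustiveness shows that \<open>E\<close> is nonempty, so \<open>E\<close> determines
  \<open>v\<close>.
\<close>

lemma FE_at_set_rng:
  assumes "FE_at v E"
  shows "set_rng L E = v"
proof -
  have v: "v \<in> vertices L" "E \<subseteq> paths_at L v" using assms by (auto simp: FE_at_def)
  have "v \<in> paths_at L v" using vertexD v(1) by (simp add: paths_at_def)
  then obtain q where "q \<in> E" using assms by (auto simp: FE_at_def)
  then show ?thesis unfolding set_rng_def using v
    by (intro the_equality) (auto simp: paths_at_def)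
qed

lemma FE_at_of_FE: "E \<in> FE L \<Longrightarrow> FE_at (set_rng L E) E"
  using FE_iff FE_at_set_rng by blast

lemma FE_atI_FE: "FE_at v E \<Longrightarrow> E \<in> FE L"
  using FE_iff by blast

section \<open>The four operations on finite exhaustive sets\<close>

lemma FE_at_superset:
  "\<lbrakk>FE_at v E; finite F; E \<subseteq> F; F \<subseteq> paths_at L v - vertices L\<rbrakk> \<Longrightarrow> FE_at v F"
  by (rule FE_atI) (simp_all add: FE_at_def, meson subsetD)

text \<open>Truncating \<open>q \<in> E\<close> keeps it a prefix of whatever \<open>q\<close> is a prefix of.\<close>

lemma FE_at_segments:
  assumes E: "FE_at v E" and n: "\<forall>p \<in> E. 0 < n p \<and> n p \<le> deg L p"
  shows "FE_at v {segment L p 0 (n p) | p. p \<in> E}"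
proof -
  let ?S = "{segment L p 0 (n p) | p. p \<in> E}"
  have Ep: "E \<subseteq> paths_at L v" using E by (auto simp: FE_at_def)
  have seg: "segment L p 0 (n p) \<preceq> p" "deg L (segment L p 0 (n p)) = n p" if "p \<in> E" for p
    using that n Ep prefix_segment[of p "n p"] by (auto simp: paths_at_def)
  have "segment L p 0 (n p) \<in> paths_at L v - vertices L" if "p \<in> E" for p
    using seg[OF that] prefix_paths[OF seg(1)[OF that]] that n Ep
      nonvertex_iff_deg[of "segment L p 0 (n p)"] by (auto simp: paths_at_def)
  then have "v \<in> vertices L" "?S \<subseteq> paths_at L v - vertices L"
    using E unfolding FE_at_def by blast+
  moreover have "finite ?S" using E by (simp add: FE_at_def Setcompr_eq_image)
  moreover have "\<exists>q \<in> ?S. \<exists>t. p \<preceq> t \<and> q \<preceq> t" if p: "p \<in> paths_at L v" for p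
  proof -
    obtain q t where q: "q \<in> E" "p \<preceq> t" "q \<preceq> t" by (rule FE_at_common_extension[OF E p])
    then have "segment L q 0 (n q) \<preceq> t" using seg prefix_trans by blast
    then show ?thesis using q by blast
  qed
  ultimately show ?thesis by (rule FE_atI)
qed

text \<open>
  Exhaustiveness is inherited from the attached sets by going beyond a common extension already
  found: if \<open>p\<close> and \<open>q \<in> F\<close> are both prefixes of \<open>t = q \<cdot> x\<close>, then \<open>x\<close> has a common extension \<open>u\<close> with
  some \<open>h\<close> in the set attached to \<open>q\<close>, and \<open>q \<cdot> u\<close> extends both \<open>p\<close> and \<open>q \<cdot> h\<close>.
\<close>

lemma FE_at_compose:
  assumes E: "FE_at v E" and F: "F \<subseteq> E" and H: "\<forall>p \<in> F. FE_at (src L p) (H p)"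
  shows "FE_at v ((E - F) \<union> (\<Union>p \<in> F. path_times_set L p (H p)))" (is "FE_at v ?S")
proof -
  have Ep: "E \<subseteq> paths_at L v - vertices L" using E by (auto simp: FE_at_def)
  have Hp: "h \<in> paths L" "rng L h = src L q" if "q \<in> F" "h \<in> H q" for q h
    using H that by (auto simp: FE_at_def paths_at_def)
  have "path_times_set L q (H q) \<subseteq> paths_at L v - vertices L" if q: "q \<in> F" for q
  proof
    fix t assume "t \<in> path_times_set L q (H q)"
    then obtain h where h: "h \<in> H q" "t = q \<cdot> h" by (auto simp: path_times_set_def)
    have qp: "q \<in> paths L" "rng L q = v" "q \<notin> vertices L"
      using q F Ep by (auto simp: paths_at_def)
    have "q \<preceq> t" using h Hp[OF q] qp by (simp add: prefix_comp)
    then show "t \<in> paths_at L v - vertices L"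
      using prefix_paths deg_mono_nonvertex qp by (auto simp: paths_at_def)
  qed
  then have "v \<in> vertices L" "?S \<subseteq> paths_at L v - vertices L"
    using E Ep unfolding FE_at_def by blast+
  moreover have "finite ?S"
  proof -
    have "finite (path_times_set L q (H q))" if "q \<in> F" for q
      using H that by (simp add: FE_at_def path_times_set_def)
    then show ?thesis using E F by (auto simp: FE_at_def intro: finite_subset)
  qed
  moreover have "\<exists>q \<in> ?S. \<exists>t. p \<preceq> t \<and> q \<preceq> t" if p: "p \<in> paths_at L v" for p
  proof -
    obtain q t where q: "q \<in> E" "p \<preceq> t" "q \<preceq> t" by (rule FE_at_common_extension[OF E p])
    show ?thesis
    proof (cases "q \<in> F")
      case False
      then show ?thesis using q by blast
    next
      case True
      obtain x where x: "q \<in> paths L" "x \<in> paths L" "src L q = rng L x" "t = q \<cdot> x"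
        using q(3) by (auto simp: is_prefix_def)
      then have "x \<in> paths_at L (src L q)" by (simp add: paths_at_def)
      then obtain h u where h: "h \<in> H q" "x \<preceq> u" "h \<preceq> u"
        using FE_at_common_extension H True by metis
      have "t \<preceq> q \<cdot> u" "q \<cdot> h \<preceq> q \<cdot> u"
        using prefix_comp_left x h Hp[OF True h(1)] by auto
      then have "p \<preceq> q \<cdot> u" "q \<cdot> h \<preceq> q \<cdot> u" using q prefix_trans by blast+
      moreover have "q \<cdot> h \<in> ?S"
        using True h Hp[OF True h(1)] by (auto simp: path_times_set_def)
      ultimately show ?thesis by blast
    qed
  qed
  ultimately show ?thesis by (rule FE_atI)
qed

text \<open>
  With the next lemma: the vertex \<open>v\<close> is an admissible \<open>\<mu>\<close> in \<open>\<Sigma>\<^sub>2\<close> and reproduces \<open>E\<close>. Here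
  the join of degrees is \<open>deg L q\<close>, so the minimal common extension of \<open>v\<close> and \<open>q\<close> is \<open>q\<close> itself.
\<close>

lemma Ext_vertex:
  assumes "FE_at v E"
  shows "Ext L v E = E"
proof -
  have v: "v \<in> paths L" "src L v = v" "deg L v = 0"
    using assms vertexD by (auto simp: FE_at_def)
  have Ep: "E \<subseteq> paths_at L v" using assms by (auto simp: FE_at_def)
  have join: "degree_join 0 n = n" for n :: "nat ^ 'k"
    by (simp add: degree_join_def vec_eq_iff)
  have "a \<in> Ext L v E \<longleftrightarrow> a \<in> E" for a
  proof
    assume "a \<in> Ext L v E"
    then obtain q where a: "a \<in> paths_at L v" and q: "q \<in> E" "q \<preceq> v \<cdot> a" "deg L (v \<cdot> a) = deg L q"
      using v join by (auto simp: Ext_iff MCE_iff)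
    have "v \<cdot> a = a" using a rng_comp_id by (auto simp: paths_at_def)
    then have "q = a" using q segment_prefix segment_full prefix_paths(2) by metis
    then show "a \<in> E" using q by simp
  next
    assume a: "a \<in> E"
    then have "a \<in> paths L" "rng L a = v" using Ep by (auto simp: paths_at_def)
    then have "v \<cdot> a = a" "v \<preceq> v \<cdot> a" using rng_comp_id prefix_comp v by auto
    then have "v \<cdot> a \<in> MCE L v a"
      using v join prefix_refl \<open>a \<in> paths L\<close> by (simp add: MCE_iff)
    then show "a \<in> Ext L v E" using a Ep v by (auto simp: Ext_iff)
  qed
  then show ?thesis by blast
qed

lemma FE_at_vertex_not_extension:
  assumes "FE_at v E"
  shows "v \<in> paths_at L v - extensions_of L E"
proof -
  have v: "v \<in> vertices L" using assms by (simp add: FE_at_def)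
  have "v \<noteq> q \<cdot> x" if "q \<in> E" "x \<in> paths_at L (src L q)" for q x
  proof -
    have "q \<preceq> q \<cdot> x" "q \<notin> vertices L"
      using that assms prefix_comp by (auto simp: paths_at_def FE_at_def)
    then show ?thesis using deg_mono_nonvertex v by metis
  qed
  then show ?thesis using vertexD[OF v] by (auto simp: extensions_of_def paths_at_def)
qed

end

context finitely_aligned_k_graph
begin

text \<open>
  Finiteness is finite alignment, as \<open>a \<mapsto> p \<cdot> a\<close> is injective. The hypothesis on \<open>p\<close> keeps the vertex
  \<open>src L p\<close> out of \<open>Ext L p E\<close>: if \<open>p = p \<cdot> src L p\<close> extends some \<open>q \<in> E\<close>, then \<open>p\<close> lies in
  \<open>extensions_of L E\<close>. For exhaustiveness, a path \<open>x\<close> is translated to \<open>p \<cdot> x\<close>: a common extension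
  of this with \<open>q \<in> E\<close> has a minimal common extension \<open>p \<cdot> a\<close> of \<open>p\<close> and \<open>q\<close> as a prefix, and
  cancelling \<open>p\<close> leaves a common extension of \<open>x\<close> and \<open>a\<close>.
\<close>

lemma FE_at_Ext:
  assumes E: "FE_at v E" and p: "p \<in> paths_at L v - extensions_of L E"
  shows "FE_at (src L p) (Ext L p E)"
proof -
  have pp: "p \<in> paths L" "rng L p = v" using p by (auto simp: paths_at_def)
  have Ep: "E \<subseteq> paths L" using E by (auto simp: FE_at_def paths_at_def)
  have fin: "finite (Ext L p E)"
  proof (rule finite_imageD)
    have "(\<lambda>a. p \<cdot> a) ` Ext L p E \<subseteq> (\<Union>q \<in> E. MCE L p q)" using Ext_iff[OF pp(1)] by blast
    moreover have "finite (\<Union>q \<in> E. MCE L p q)"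
      using E Ep pp finite_MCE by (auto simp: FE_at_def)
    ultimately show "finite ((\<lambda>a. p \<cdot> a) ` Ext L p E)" by (rule finite_subset)
    show "inj_on (\<lambda>a. p \<cdot> a) (Ext L p E)"
      using comp_left_cancel pp(1) by (auto simp: inj_on_def Ext_def paths_at_def)
  qed
  have "src L p \<in> vertices L" by (rule src_vertex[OF pp(1)])
  moreover have "Ext L p E \<subseteq> paths_at L (src L p) - vertices L"
  proof
    fix a assume "a \<in> Ext L p E"
    then obtain q where a: "a \<in> paths_at L (src L p)" and q: "q \<in> E" "q \<preceq> p \<cdot> a"
      using pp by (auto simp: Ext_iff MCE_iff)
    have "a \<notin> vertices L"
    proof
      assume "a \<in> vertices L"
      then have "a = src L p" using a vertex_rng_eq by (auto simp: paths_at_def)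
      then have "q \<preceq> p" using q pp comp_src_id by simp
      then have "p \<in> extensions_of L E"
        using q(1) unfolding is_prefix_def extensions_of_def paths_at_def by fastforce
      then show False using p by simp
    qed
    then show "a \<in> paths_at L (src L p) - vertices L" using a by simp
  qed
  moreover note fin
  moreover have "\<exists>a \<in> Ext L p E. \<exists>t. x \<preceq> t \<and> a \<preceq> t" if x: "x \<in> paths_at L (src L p)" for x
  proof -
    have xp: "x \<in> paths L" "src L p = rng L x" using x by (auto simp: paths_at_def)
    then have "p \<cdot> x \<in> paths_at L v" using pp by (simp add: paths_at_def comp_closed rng_comp)
    then obtain q t where q: "q \<in> E" "p \<cdot> x \<preceq> t" "q \<preceq> t"
      by (rule FE_at_common_extension[OF E])
    have pt: "p \<preceq> t" using q(2) prefix_trans prefix_comp pp xp by blast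
    then obtain a where a: "a \<in> paths_at L (src L p)" "p \<cdot> a \<in> MCE L p q" "p \<cdot> a \<preceq> t"
      using common_extension_minimal q(3) by blast
    obtain y where y: "y \<in> paths L" "src L p = rng L y" "t = p \<cdot> y"
      using pt by (auto simp: is_prefix_def)
    have "x \<preceq> y" "a \<preceq> y"
      using prefix_cancel_left pp xp q(2) a y by (auto simp: paths_at_def)
    then show ?thesis using a q(1) Ext_iff[OF pp(1)] by blast
  qed
  ultimately show ?thesis by (rule FE_atI)
qed

section \<open>Closure operators and satiated families\<close>

lemma Sigma1_FE: "\<A> \<subseteq> FE L \<Longrightarrow> Sigma1 L \<A> \<subseteq> FE L"
  unfolding Sigma1_def using FE_at_of_FE FE_at_superset FE_atI_FE by blast

lemma Sigma2_FE: "\<A> \<subseteq> FE L \<Longrightarrow> Sigma2 L \<A> \<subseteq> FE L"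
  unfolding Sigma2_def using FE_at_of_FE FE_at_Ext FE_atI_FE by blast

lemma Sigma3_FE: "\<A> \<subseteq> FE L \<Longrightarrow> Sigma3 L \<A> \<subseteq> FE L"
  unfolding Sigma3_def using FE_at_of_FE FE_at_segments FE_atI_FE by blast

lemma Sigma4_FE:
  assumes "\<A> \<subseteq> FE L"
  shows "Sigma4 L \<A> \<subseteq> FE L"
proof
  fix S assume "S \<in> Sigma4 L \<A>"
  then obtain E F H where S: "S = (E - F) \<union> (\<Union>p \<in> F. path_times_set L p (H p))"
      "E \<in> \<A>" "F \<subseteq> E" "\<forall>p \<in> F. H p \<in> members_at L (src L p) \<A>"
    unfolding Sigma4_def by blast
  have "FE_at (src L p) (H p)" if "p \<in> F" for p
    using S(4) that assms FE_at_of_FE[of "H p"] by (auto simp: members_at_def)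
  then have "FE_at (set_rng L E) S"
    unfolding S(1) using FE_at_compose[of "set_rng L E" E F H] FE_at_of_FE S assms by blast
  then show "S \<in> FE L" by (rule FE_atI_FE)
qed

lemma Sigma1_extensive:
  assumes "\<A> \<subseteq> FE L"
  shows "\<A> \<subseteq> Sigma1 L \<A>"
proof
  fix E assume E: "E \<in> \<A>"
  then have "FE_at (set_rng L E) E" using assms FE_at_of_FE by blast
  then show "E \<in> Sigma1 L \<A>" using E unfolding Sigma1_def FE_at_def by blast
qed

lemma Sigma2_extensive:
  assumes "\<A> \<subseteq> FE L"
  shows "\<A> \<subseteq> Sigma2 L \<A>"
proof
  fix E assume E: "E \<in> \<A>"
  then have at: "FE_at (set_rng L E) E" using assms FE_at_of_FE by blast
  have "E = Ext L (set_rng L E) E" using Ext_vertex[OF at] by simp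
  then show "E \<in> Sigma2 L \<A>"
    using E FE_at_vertex_not_extension[OF at] unfolding Sigma2_def by blast
qed

lemma Sigma3_extensive:
  assumes "\<A> \<subseteq> FE L"
  shows "\<A> \<subseteq> Sigma3 L \<A>"
proof
  fix E assume E: "E \<in> \<A>"
  then have "FE_at (set_rng L E) E" using assms FE_at_of_FE by blast
  then have Ep: "E \<subseteq> paths L" "\<forall>p \<in> E. 0 < deg L p"
    using nonvertex_iff_deg by (auto simp: FE_at_def paths_at_def)
  then have "E = {segment L p 0 (deg L p) | p. p \<in> E}"
    using segment_full by (force simp: subset_iff)
  then show "E \<in> Sigma3 L \<A>" using E Ep(2) unfolding Sigma3_def by blast
qed

lemma Sigma4_extensive: "\<A> \<subseteq> Sigma4 L \<A>"
proof
  fix E assume "E \<in> \<A>"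
  moreover have "E = (E - {}) \<union> (\<Union>p \<in> {}. path_times_set L p {})" by simp
  ultimately show "E \<in> Sigma4 L \<A>" unfolding Sigma4_def by blast
qed

lemma Sigma_mono:
  assumes "\<A> \<subseteq> \<B>"
  shows "Sigma1 L \<A> \<subseteq> Sigma1 L \<B>" "Sigma2 L \<A> \<subseteq> Sigma2 L \<B>"
    "Sigma3 L \<A> \<subseteq> Sigma3 L \<B>" "Sigma4 L \<A> \<subseteq> Sigma4 L \<B>"
proof -
  show "Sigma1 L \<A> \<subseteq> Sigma1 L \<B>" "Sigma2 L \<A> \<subseteq> Sigma2 L \<B>" "Sigma3 L \<A> \<subseteq> Sigma3 L \<B>"
    using assms unfolding Sigma1_def Sigma2_def Sigma3_def by blast+
  have "members_at L v \<A> \<subseteq> members_at L v \<B>" for v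
    using assms by (auto simp: members_at_def)
  then show "Sigma4 L \<A> \<subseteq> Sigma4 L \<B>"
    using assms unfolding Sigma4_def by (smt (verit) Collect_mono subsetD)
qed

lemma Sigma_map_FE: "\<A> \<subseteq> FE L \<Longrightarrow> Sigma_map L \<A> \<subseteq> FE L"
  by (simp add: Sigma_map_def Sigma1_FE Sigma2_FE Sigma3_FE Sigma4_FE)

text \<open>
  Each single operation is absorbed by the composite, because the other three only enlarge a
  family.
\<close>

lemma Sigma_i_subset_Sigma_map:
  assumes "\<A> \<subseteq> FE L"
  shows "\<A> \<subseteq> Sigma_map L \<A>" "Sigma1 L \<A> \<subseteq> Sigma_map L \<A>" "Sigma2 L \<A> \<subseteq> Sigma_map L \<A>"
    "Sigma3 L \<A> \<subseteq> Sigma_map L \<A>" "Sigma4 L \<A> \<subseteq> Sigma_map L \<A>"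
proof -
  let ?S1 = "Sigma1 L \<A>" and ?S2 = "Sigma2 L (Sigma1 L \<A>)"
    and ?S3 = "Sigma3 L (Sigma2 L (Sigma1 L \<A>))"
  have map: "Sigma_map L \<A> = Sigma4 L ?S3" by (simp add: Sigma_map_def)
  have fe: "?S1 \<subseteq> FE L" "?S2 \<subseteq> FE L"
    using assms by (simp_all add: Sigma1_FE Sigma2_FE)
  have ext: "\<A> \<subseteq> ?S1" "?S1 \<subseteq> ?S2" "?S2 \<subseteq> ?S3" "?S3 \<subseteq> Sigma_map L \<A>"
    unfolding map using assms fe Sigma1_extensive Sigma2_extensive Sigma3_extensive
      Sigma4_extensive by simp_all
  show "\<A> \<subseteq> Sigma_map L \<A>" "?S1 \<subseteq> Sigma_map L \<A>" using ext by blast+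
  show "Sigma2 L \<A> \<subseteq> Sigma_map L \<A>" using Sigma_mono(2)[OF ext(1)] ext by blast
  have "\<A> \<subseteq> ?S2" using ext by blast
  then show "Sigma3 L \<A> \<subseteq> Sigma_map L \<A>" using Sigma_mono(3) ext by blast
  have "\<A> \<subseteq> ?S3" using ext by blast
  then show "Sigma4 L \<A> \<subseteq> Sigma_map L \<A>" unfolding map by (rule Sigma_mono(4))
qed

text \<open>
  For (S1) and \<open>\<Sigma>\<^sub>1\<close> this says that, among the sets containing some \<open>G \<in> \<F>\<close>, the finite exhaustive
  ones are the finite sets of nonvertex paths with the range of \<open>G\<close>. The other three conditions
  match literally.
\<close>

lemma satiated_iff:
  "satiated L \<F> \<longleftrightarrow> \<F> \<subseteq> FE L \<and>
     Sigma1 L \<F> \<subseteq> \<F> \<and> Sigma2 L \<F> \<subseteq> \<F> \<and> Sigma3 L \<F> \<subseteq> \<F> \<and> Sigma4 L \<F> \<subseteq> \<F>"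
proof (cases "\<F> \<subseteq> FE L")
  case False
  then show ?thesis by (simp add: satiated_def)
next
  case True
  \<comment> \<open>(S1) mentions no vertex, but a finite exhaustive set containing \<open>G\<close> has the same range as \<open>G\<close>.\<close>
  have super: "E \<in> FE L \<longleftrightarrow> finite E \<and> E \<subseteq> paths_at L (set_rng L G) - vertices L"
    if G: "G \<in> \<F>" and GE: "G \<subseteq> E" for G E
  proof
    have at: "FE_at (set_rng L G) G" using G True FE_at_of_FE by blast
    then have "set_rng L G \<in> paths_at L (set_rng L G)"
      by (simp add: FE_at_def paths_at_def vertexD)
    then obtain q where q: "q \<in> G" "rng L q = set_rng L G"
      using at unfolding FE_at_def paths_at_def by blast
    assume "E \<in> FE L"
    then have E: "FE_at (set_rng L E) E" by (rule FE_at_of_FE)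
    then have "set_rng L E = set_rng L G"
      using q GE by (auto simp: FE_at_def paths_at_def)
    then show "finite E \<and> E \<subseteq> paths_at L (set_rng L G) - vertices L"
      using E unfolding FE_at_def by simp
  next
    have at: "FE_at (set_rng L G) G" using G True FE_at_of_FE by blast
    assume "finite E \<and> E \<subseteq> paths_at L (set_rng L G) - vertices L"
    then show "E \<in> FE L" using FE_at_superset[OF at] GE FE_atI_FE by blast
  qed
  have "(\<forall>G \<in> \<F>. \<forall>E \<in> FE L. G \<subseteq> E \<longrightarrow> E \<in> \<F>) \<longleftrightarrow> Sigma1 L \<F> \<subseteq> \<F>"
  proof -
    have "E \<in> Sigma1 L \<F> \<longleftrightarrow> (\<exists>G \<in> \<F>. G \<subseteq> E \<and> E \<in> FE L)" for E
      using super[of _ E] by (auto simp: Sigma1_def cong: conj_cong bex_cong)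
    then show ?thesis by blast
  qed
  moreover have "(\<forall>G \<in> \<F>. \<forall>p \<in> paths_at L (set_rng L G) - extensions_of L G. Ext L p G \<in> \<F>)
      \<longleftrightarrow> Sigma2 L \<F> \<subseteq> \<F>"
    unfolding Sigma2_def by blast
  moreover have "(\<forall>G \<in> \<F>. \<forall>n. (\<forall>p \<in> G. 0 < n p \<and> n p \<le> deg L p) \<longrightarrow>
      {segment L p 0 (n p) | p. p \<in> G} \<in> \<F>) \<longleftrightarrow> Sigma3 L \<F> \<subseteq> \<F>"
    unfolding Sigma3_def by blast
  moreover have "(\<forall>G \<in> \<F>. \<forall>G' H. G' \<subseteq> G \<and> (\<forall>p \<in> G'. H p \<in> \<F> \<and> set_rng L (H p) = src L p) \<longrightarrow>
      (G - G') \<union> (\<Union>p \<in> G'. path_times_set L p (H p)) \<in> \<F>) \<longleftrightarrow> Sigma4 L \<F> \<subseteq> \<F>"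
    unfolding Sigma4_def members_at_def by blast
  ultimately show ?thesis using True unfolding satiated_def by (simp only:)
qed

lemma Sigma_map_subset_satiated:
  assumes "satiated L \<F>" "\<A> \<subseteq> \<F>"
  shows "Sigma_map L \<A> \<subseteq> \<F>"
proof -
  have closed: "Sigma1 L \<F> \<subseteq> \<F>" "Sigma2 L \<F> \<subseteq> \<F>" "Sigma3 L \<F> \<subseteq> \<F>" "Sigma4 L \<F> \<subseteq> \<F>"
    using assms(1) by (simp_all add: satiated_iff)
  have "Sigma4 L (Sigma3 L (Sigma2 L (Sigma1 L \<A>))) \<subseteq> \<F>"
    by (intro subset_trans[OF Sigma_mono(4) closed(4)] subset_trans[OF Sigma_mono(3) closed(3)]
        subset_trans[OF Sigma_mono(2) closed(2)] subset_trans[OF Sigma_mono(1) closed(1)] assms(2))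
  then show ?thesis by (simp add: Sigma_map_def)
qed

lemma Sigma_iterate_FE: "\<A> \<subseteq> FE L \<Longrightarrow> (Sigma_map L ^^ n) \<A> \<subseteq> FE L"
  by (induction n) (simp_all add: Sigma_map_FE)

lemma Sigma_iterate_mono:
  assumes "\<A> \<subseteq> FE L" "m \<le> n"
  shows "(Sigma_map L ^^ m) \<A> \<subseteq> (Sigma_map L ^^ n) \<A>"
  using assms(2)
  by (rule lift_Suc_mono_le[rotated])
    (simp add: Sigma_i_subset_Sigma_map(1) Sigma_iterate_FE assms(1))

text \<open>Since the chain increases, the stage \<open>0\<close> can be included in the union.\<close>

lemma Sigma_infinity_eq:
  assumes "\<A> \<subseteq> FE L"
  shows "Sigma_infinity L \<A> = (\<Union>n. (Sigma_map L ^^ n) \<A>)"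
proof -
  have "(Sigma_map L ^^ n) \<A> \<subseteq> (Sigma_map L ^^ Suc n) \<A>" for n
    by (rule Sigma_iterate_mono[OF assms]) simp
  moreover have "Suc n \<in> {1..}" for n by simp
  ultimately show ?thesis unfolding Sigma_infinity_def by blast
qed

text \<open>
  In (S4) the finitely many sets involved may enter the chain at different stages; the maximum \<open>N\<close>
  of these stages contains them all.
\<close>

lemma satiated_Sigma_infinity:
  assumes "\<A> \<subseteq> FE L"
  shows "satiated L (Sigma_infinity L \<A>)"
proof -
  define S where "S n = (Sigma_map L ^^ n) \<A>" for n
  define U where "U = (\<Union>n. S n)"
  have FE: "S n \<subseteq> FE L" for n unfolding S_def by (rule Sigma_iterate_FE[OF assms])
  have mono: "S m \<subseteq> S n" if "m \<le> n" for m n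
    unfolding S_def by (rule Sigma_iterate_mono[OF assms that])
  have Suc: "Sigma_map L (S n) = S (Suc n)" for n by (simp add: S_def)
  note next_stage = Sigma_i_subset_Sigma_map[OF FE, unfolded Suc]
  have "Sigma1 L U \<subseteq> (\<Union>n. Sigma1 L (S n))" "Sigma2 L U \<subseteq> (\<Union>n. Sigma2 L (S n))"
    "Sigma3 L U \<subseteq> (\<Union>n. Sigma3 L (S n))"
    unfolding U_def Sigma1_def Sigma2_def Sigma3_def by blast+
  moreover have "Sigma4 L U \<subseteq> (\<Union>n. Sigma4 L (S n))"
  proof
    fix X assume "X \<in> Sigma4 L U"
    then obtain E F H where X: "X = (E - F) \<union> (\<Union>p \<in> F. path_times_set L p (H p))"
        "E \<in> U" "F \<subseteq> E" "\<forall>p \<in> F. H p \<in> members_at L (src L p) U"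
      unfolding Sigma4_def by blast
    obtain m where m: "E \<in> S m" using X(2) by (auto simp: U_def)
    have "\<forall>p \<in> F. \<exists>n. H p \<in> S n" using X(4) by (auto simp: U_def members_at_def)
    then obtain f where f: "\<forall>p \<in> F. H p \<in> S (f p)" by metis
    have "finite E" using m FE FE_at_of_FE unfolding FE_at_def by blast
    then have fin: "finite F" using X(3) finite_subset by blast
    define N where "N = Max (insert m (f ` F))"
    have N: "m \<le> N" "\<forall>p \<in> F. f p \<le> N" using fin by (auto simp: N_def)
    have "E \<in> S N" using m mono N(1) by blast
    moreover have "\<forall>p \<in> F. H p \<in> members_at L (src L p) (S N)"
      using X(4) f mono N(2) unfolding members_at_def by blast
    ultimately have "X \<in> Sigma4 L (S N)" using X(1,3) unfolding Sigma4_def by blast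
    then show "X \<in> (\<Union>n. Sigma4 L (S n))" by blast
  qed
  moreover have "(\<Union>n. S (Suc n)) \<subseteq> U" by (auto simp: U_def)
  ultimately have "Sigma1 L U \<subseteq> U" "Sigma2 L U \<subseteq> U" "Sigma3 L U \<subseteq> U" "Sigma4 L U \<subseteq> U"
    using next_stage(2-5) by (meson SUP_mono' order_trans)+
  moreover have "U \<subseteq> FE L" using FE by (auto simp: U_def)
  moreover have "U = Sigma_infinity L \<A>" by (simp add: U_def S_def Sigma_infinity_eq[OF assms])
  ultimately show ?thesis using satiated_iff by simp
qed

lemma Sigma_infinity_least:
  assumes "\<A> \<subseteq> \<F>" "satiated L \<F>"
  shows "Sigma_infinity L \<A> \<subseteq> \<F>"
proof -
  have "(Sigma_map L ^^ n) \<A> \<subseteq> \<F>" for n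
    by (induction n) (simp_all add: assms Sigma_map_subset_satiated)
  then show ?thesis unfolding Sigma_infinity_def by blast
qed

end

theorem proposition5p5:
  fixes L :: "('p, 'k::finite) kgraph" and \<E> :: "'p set set"
  assumes "finitely_aligned_k_graph L"
    and "\<E> \<subseteq> FE L"
  shows "Sigma_infinity L \<E> = satiation L \<E>"
proof -
  interpret finitely_aligned_k_graph L by (rule assms(1))
  have "(Sigma_map L ^^ 0) \<E> \<subseteq> Sigma_infinity L \<E>"
    unfolding Sigma_infinity_eq[OF assms(2)] by blast
  then have "\<E> \<subseteq> Sigma_infinity L \<E>" by simp
  moreover have "satiated L (Sigma_infinity L \<E>)" by (rule satiated_Sigma_infinity[OF assms(2)])
  moreover have "Sigma_infinity L \<E> \<subseteq> FE L" using calculation(2) satiated_iff by blast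
  ultimately show ?thesis
    unfolding satiation_def using Sigma_infinity_least
    by (intro Least_equality[symmetric]) auto
qed

end
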